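(* In the setting of the context, suppose the infinitesimal generator $$G(\cdot\mid x,a,\mu)=\lim_{h\to0}\frac{p_h(\cdot\mid x,a,\mu)-\mathbf{1}_x}{h}$$ exists and is uniformly bounded over all $(x',x,a,\mu)\in\mathcal{X}\times\mathcal{X}\times\mathcal{A}\times\mathcal{P}(\mathcal{X})$, where $\mathbf{1}_x$ is the unit point mass at $x$, and suppose $f$ is uniformly bounded over $\mathcal{X}\times\mathcal{A}\times\mathcal{P}(\mathcal{X})$. Then the discrete optimal value functions and Q-functions, obtained by taking the infimum over all admissible policies $\alpha$, satisfy, for every $(x,a)\in\mathcal{X}\times\mathcal{A}$ and (in the MFG case) every fixed $\mu\in\mathcal{P}(\mathcal{X})$, for sufficiently small $h>0$, $$Q^{\mu}_{h,\mathrm{MFG}}(x,a)=V^{\mu}_{h,\mathrm{MFG}}(x)+O(h),\qquad Q_{h,\mathrm{MFC}}(x,a)=V_{h,\mathrm{MFC}}(x)+O(h).$$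
   Context: $\mathcal{X},\mathcal{A}$ are finite sets (states, actions), $\mathcal{P}(\mathcal{X})$ is the set of probability measures on $\mathcal{X}$, $\gamma>0$ is fixed, $f:\mathcal{X}\times\mathcal{A}\times\mathcal{P}(\mathcal{X})\to\mathbb{R}_+$ is a running cost, and for each time step $h>0$, $p_h(\cdot\mid x,a,\mu)\in\mathcal{P}(\mathcal{X})$ is the one-step transition probability. A policy is a map $\alpha:\mathcal{X}\to\mathcal{A}$. $\mathcal{P}[X]$ denotes the law of $X$. MFG: for fixed $\mu$, $(X_k^{\alpha,\mu})$ is the chain with $X_{k+1}\sim p_h(\cdot\mid X_k,\alpha_k,\mu)$, $\alpha_k=\alpha(X_k)$ (when conditioning on $\alpha_0=a$, the action $a$ is used at step $0$ and $\alpha(X_k)$ for $k\ge1$), and $$V^{\mu,\alpha}_{h,\mathrm{MFG}}(x)=\mathbb{E}\Big[h\sum_{k=0}^\infty e^{-k\gamma h}f(X_k^{\alpha,\mu},\alpha_k,\mu)\Big|X_0=x\Big],$$ $$Q^{\mu,\alpha}_{h,\mathrm{MFG}}(x,a)=\mathbb{E}\Big[h\sum_{k=0}^\infty e^{-k\gamma h}f(X_k^{\alpha,\mu},\alpha_k,\mu)\Big|X_0=x,\alpha_0=a\Big].$$ MFC (asymptotic): for each policy $\alpha$, $\mu^\alpha=\lim_{k\to\infty}\mathcal{P}[X_k^\alpha]$ is the limiting law (assumed to exist) of the chain with $X_{k+1}^\alpha\sim p_h(\cdot\mid X_k^\alpha,\alpha(X_k^\alpha),\mu^\alpha)$ started from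 a given initial law, and $$V^\alpha_{h,\mathrm{MFC}}(x)=\mathbb{E}\Big[h\sum_{k=0}^\infty e^{-k\gamma h}f(X_k^\alpha,\alpha_k,\mu^\alpha)\Big|X_0=x\Big],$$ $$Q^\alpha_{h,\mathrm{MFC}}(x,a)=hf(x,a,\mu^{\tilde\alpha})+\mathbb{E}\Big[h\sum_{k=1}^\infty e^{-k\gamma h}f(X_k^\alpha,\alpha_k,\mu^\alpha)\Big|X_0=x,\alpha_0=a\Big],$$ where the modified policy $\tilde\alpha$ (depending on $(x,a)$) is $\tilde\alpha(s)=\alpha(s)$ for $s\ne x$ and $\tilde\alpha(x)=a$. In the last expectation $X_1\sim p_h(\cdot\mid x,a,\mu^\alpha)$ and afterwards $\alpha_k=\alpha(X_k^\alpha)$. Optimal functions: $V^\mu_{h,\mathrm{MFG}}(x)=\inf_\alpha V^{\mu,\alpha}_{h,\mathrm{MFG}}(x)$, $Q^\mu_{h,\mathrm{MFG}}(x,a)=\inf_\alpha Q^{\mu,\alpha}_{h,\mathrm{MFG}}(x,a)$, $V_{h,\mathrm{MFC}}(x)=\inf_\alpha V^\alpha_{h,\mathrm{MFC}}(x)$, $Q_{h,\mathrm{MFC}}(x,a)=\inf_\alpha Q^\alpha_{h,\mathrm{MFC}}(x,a)$, the infima being over all policies.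
   Formalization: For the MFC estimate the limit defining the generator G is additionally assumed to be uniform over all (x',x,a,μ); with only a pointwise limit in μ the MFC estimate is false, because the limiting law μ^α moves with h. *)

theory Defs
  imports "HOL-Probability.Probability" "HOL-Library.Landau_Symbols"
begin

section \<open>Controlled Markov chains\<close>

text \<open>
  Probability measures on a finite set of states are elements of type \<open>'x pmf\<close>.
  The path measure of the time-inhomogeneous Markov chain \<open>X 0, X 1, ...\<close> with
  \<open>X 0 \<sim> \<nu>\<close> and \<open>X (Suc k) \<sim> K k (X k)\<close> is obtained from the Ionescu-Tulcea theorem;
  \<open>X k\<close> is the coordinate \<open>\<lambda>\<omega>. \<omega> k\<close>. The lemma \<open>measure_path_cylinder\<close> below gives its
  finite-dimensional distributions.
\<close>

definition step_kernel :: "'x pmf \<Rightarrow> (nat \<Rightarrow> 'x \<Rightarrow> 'x pmf) \<Rightarrow> nat \<Rightarrow> (nat \<Rightarrow> 'x) \<Rightarrow> 'x measure" where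
  "step_kernel \<nu> K n \<omega> = measure_pmf (case n of 0 \<Rightarrow> \<nu> | Suc k \<Rightarrow> K k (\<omega> k))"

definition path_measure :: "'x pmf \<Rightarrow> (nat \<Rightarrow> 'x \<Rightarrow> 'x pmf) \<Rightarrow> (nat \<Rightarrow> 'x) measure" where
  "path_measure \<nu> K =
     projective_family.lim UNIV
       (Ionescu_Tulcea.CI (step_kernel \<nu> K) (\<lambda>_. count_space UNIV)) (\<lambda>_. count_space UNIV)"

lemma Ionescu_Tulcea_step_kernel:
  "Ionescu_Tulcea (step_kernel \<nu> K) (\<lambda>_. count_space UNIV)"
proof (rule Ionescu_Tulcea.intro)
  fix i
  show "step_kernel \<nu> K i \<in> PiM {0..<i} (\<lambda>_. count_space UNIV) \<rightarrow>\<^sub>M subprob_algebra (count_space UNIV)"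
  proof (cases i)
    case 0
    have "measure_pmf \<nu> \<in> space (subprob_algebra (count_space UNIV))"
      using measure_pmf_in_subprob_algebra[of \<nu>] by simp
    with 0 show ?thesis
      by (simp add: step_kernel_def[abs_def])
  next
    case (Suc k)
    have "(\<lambda>\<omega>. \<omega> k) \<in> PiM {0..<Suc k} (\<lambda>_. count_space UNIV) \<rightarrow>\<^sub>M count_space UNIV"
      by (rule measurable_component_singleton) simp
    moreover have "(\<lambda>s. measure_pmf (K k s)) \<in> count_space UNIV \<rightarrow>\<^sub>M subprob_algebra (count_space UNIV)"
      by (simp add: measure_pmf_in_subprob_algebra)
    ultimately show ?thesis
      unfolding Suc step_kernel_def[abs_def] nat.case by (rule measurable_compose)
  qed
qed (simp add: step_kernel_def measure_pmf.prob_space_axioms)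

lemma prob_space_path_measure: "prob_space (path_measure \<nu> K)"
  and sets_path_measure: "sets (path_measure \<nu> K) = sets (PiM UNIV (\<lambda>_. count_space UNIV))"
proof -
  interpret Ionescu_Tulcea "step_kernel \<nu> K" "\<lambda>_. count_space UNIV"
    by (rule Ionescu_Tulcea_step_kernel)
  show "prob_space (path_measure \<nu> K)"
  proof
    have "emeasure PF.lim (PF.emb UNIV {} {\<lambda>x. undefined}) = emeasure (CI {}) {\<lambda>x. undefined}"
      by (rule lim) (auto simp: sets_PiM_empty)
    also have "\<dots> = 1"
      using prob_space.emeasure_space_1[OF PF.prob_space_P[of "{}"]]
      by (simp add: PF.space_P space_PiM_empty)
    also have "PF.emb UNIV {} {\<lambda>x. undefined} = space PF.lim"
      by (auto simp: PF.space_lim prod_emb_def space_PiM restrict_def)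
    finally show "emeasure (path_measure \<nu> K) (space (path_measure \<nu> K)) = 1"
      unfolding path_measure_def .
  qed
  show "sets (path_measure \<nu> K) = sets (PiM UNIV (\<lambda>_. count_space UNIV))"
    unfolding path_measure_def by simp
qed

lemma measure_path_cylinder:
  "measure (path_measure \<nu> K) {\<omega>. \<forall>i\<le>n. \<omega> i = s i} =
     pmf \<nu> (s 0) * (\<Prod>i<n. pmf (K i (s i)) (s (Suc i)))"
proof -
  interpret Ionescu_Tulcea "step_kernel \<nu> K" "\<lambda>_. count_space UNIV"
    by (rule Ionescu_Tulcea_step_kernel)
  let ?S = "\<lambda>m. PiE {0..<m} (\<lambda>i. {s i})"
  let ?u = "\<lambda>x::nat. undefined :: 'a"
  have S[measurable]: "?S m \<in> sets (PiM {0..<m} (\<lambda>_. count_space UNIV))" for m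
    by (rule sets_PiM_I_finite) auto
  have u: "?u \<in> space (PiM {0..<0} (\<lambda>_. count_space UNIV))"
    by (simp add: space_PiM)
  have C: "emeasure (C 0 m ?u) (?S m) = ennreal (\<Prod>i<m. measure (step_kernel \<nu> K i s) {s i})" for m
  proof (induction m)
    case 0
    show ?case
      by (simp add: sets_PiM_empty)
  next
    case (Suc m)
    have eP: "emeasure (eP m \<omega>) (?S (Suc m)) =
        ennreal (measure (step_kernel \<nu> K m s) {s m}) * indicator (?S m) \<omega>"
      if \<omega>: "\<omega> \<in> space (PiM {0..<m} (\<lambda>_. count_space UNIV))" for \<omega>
    proof -
      have "(fun_upd \<omega> m -` ?S (Suc m) \<inter> space (count_space UNIV))
          = (if \<omega> \<in> ?S m then {s m} else {})"
        using \<omega> by (auto simp: space_PiM PiE_iff extensional_def less_Suc_eq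
            split: if_splits)
      moreover have "step_kernel \<nu> K m \<omega> = step_kernel \<nu> K m s" if "\<omega> \<in> ?S m"
        using that by (auto simp: step_kernel_def PiE_iff split: nat.split)
      ultimately show ?thesis
        using \<omega> S[of "Suc m"]
        by (subst emeasure_eP)
           (auto simp: step_kernel_def measure_pmf.emeasure_eq_measure)
    qed
    have eP_measurable:
      "eP m \<in> C 0 m ?u \<rightarrow>\<^sub>M subprob_algebra (PiM {0..<Suc m} (\<lambda>_. count_space UNIV))"
      by (subst measurable_cong_sets[OF sets_C[OF u, of m] refl]) (simp add: measurable_eP)
    have "emeasure (C 0 (Suc m) ?u) (?S (Suc m)) = (\<integral>\<^sup>+\<omega>. emeasure (eP m \<omega>) (?S (Suc m)) \<partial>C 0 m ?u)"
      using space_C[OF u, of m] eP_measurable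
      by (simp, subst emeasure_bind[OF _ _ S]) (auto simp: space_PiM)
    also have "\<dots> = (\<integral>\<^sup>+\<omega>. ennreal (measure (step_kernel \<nu> K m s) {s m}) * indicator (?S m) \<omega> \<partial>C 0 m ?u)"
      using space_C[OF u, of m] by (intro nn_integral_cong eP) simp
    also have "\<dots> = ennreal (measure (step_kernel \<nu> K m s) {s m}) * emeasure (C 0 m ?u) (?S m)"
      using S[of m] sets_C[OF u, of m] by (intro nn_integral_cmult_indicator) auto
    finally show ?case
      by (simp add: Suc.IH ennreal_mult' prod_nonneg mult.commute del: C.simps)
  qed
  have "{\<omega>. \<forall>i\<le>n. \<omega> i = s i} = PF.emb UNIV {0..<Suc n} (?S (Suc n))"
    by (auto simp: prod_emb_def space_PiM PiE_iff less_Suc_eq_le)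
  then have "emeasure (path_measure \<nu> K) {\<omega>. \<forall>i\<le>n. \<omega> i = s i}
      = emeasure (CI {0..<Suc n}) (?S (Suc n))"
    using lim[of "{0..<Suc n}" "?S (Suc n)"] S[of "Suc n"] unfolding path_measure_def by simp
  also have "\<dots> = emeasure (C 0 (Suc n) ?u) (?S (Suc n))"
    using emeasure_CI[of "{0..<Suc n}" "Suc n" "?S (Suc n)"] S[of "Suc n"]
    by (simp add: prod_emb_id PiE_iff space_PiM subset_iff del: C.simps)
  also have "\<dots> = ennreal (\<Prod>i<Suc n. measure (step_kernel \<nu> K i s) {s i})"
    by (rule C)
  also have "(\<Prod>i<Suc n. measure (step_kernel \<nu> K i s) {s i})
      = pmf \<nu> (s 0) * (\<Prod>i<n. pmf (K i (s i)) (s (Suc i)))"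
    by (subst prod.lessThan_Suc_shift) (simp add: step_kernel_def measure_pmf_single)
  finally show ?thesis
    by (simp add: measure_def prod_nonneg)
qed

section \<open>Value functions and Q-functions\<close>

text \<open>
  A control \<open>u :: nat \<Rightarrow> 'x \<Rightarrow> 'a\<close> prescribes the action \<open>u k s\<close> in state \<open>s\<close> at time \<open>k\<close>; a policy
  \<open>\<alpha>\<close> is the control \<open>\<lambda>_. \<alpha>\<close>. Conditioning on \<open>X 0 = x\<close> means starting the chain at \<open>x\<close>, and
  conditioning additionally on the action \<open>a\<close> at time \<open>0\<close> means using the control
  \<open>first_action a \<alpha>\<close>. The transition probabilities are \<open>p h x a \<mu>\<close>, for a time step \<open>h\<close>.
\<close>

definition first_action :: "'a \<Rightarrow> ('x \<Rightarrow> 'a) \<Rightarrow> nat \<Rightarrow> 'x \<Rightarrow> 'a" where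
  "first_action a \<alpha> k s = (if k = 0 then a else \<alpha> s)"

definition chain ::
  "(real \<Rightarrow> 'x \<Rightarrow> 'a \<Rightarrow> 'x pmf \<Rightarrow> 'x pmf) \<Rightarrow> real \<Rightarrow> 'x pmf \<Rightarrow> (nat \<Rightarrow> 'x \<Rightarrow> 'a) \<Rightarrow> 'x pmf
     \<Rightarrow> (nat \<Rightarrow> 'x) measure" where
  "chain p h \<mu> u \<nu> = path_measure \<nu> (\<lambda>k s. p h s (u k s) \<mu>)"

context
  fixes \<gamma> :: real
    and f :: "'x \<Rightarrow> 'a \<Rightarrow> 'x pmf \<Rightarrow> real"
    and p :: "real \<Rightarrow> 'x \<Rightarrow> 'a \<Rightarrow> 'x pmf \<Rightarrow> 'x pmf"
begin

definition V_MFG_policy :: "real \<Rightarrow> 'x pmf \<Rightarrow> ('x \<Rightarrow> 'a) \<Rightarrow> 'x \<Rightarrow> real" where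
  "V_MFG_policy h \<mu> \<alpha> x =
     (\<integral>\<omega>. h * (\<Sum>k. exp (- real k * \<gamma> * h) * f (\<omega> k) (\<alpha> (\<omega> k)) \<mu>)
        \<partial>chain p h \<mu> (\<lambda>_. \<alpha>) (return_pmf x))"

definition Q_MFG_policy :: "real \<Rightarrow> 'x pmf \<Rightarrow> ('x \<Rightarrow> 'a) \<Rightarrow> 'x \<Rightarrow> 'a \<Rightarrow> real" where
  "Q_MFG_policy h \<mu> \<alpha> x a =
     (\<integral>\<omega>. h * (\<Sum>k. exp (- real k * \<gamma> * h) * f (\<omega> k) (first_action a \<alpha> k (\<omega> k)) \<mu>)
        \<partial>chain p h \<mu> (first_action a \<alpha>) (return_pmf x))"

definition V_MFG :: "real \<Rightarrow> 'x pmf \<Rightarrow> 'x \<Rightarrow> real" where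
  "V_MFG h \<mu> x = (INF \<alpha>. V_MFG_policy h \<mu> \<alpha> x)"

definition Q_MFG :: "real \<Rightarrow> 'x pmf \<Rightarrow> 'x \<Rightarrow> 'a \<Rightarrow> real" where
  "Q_MFG h \<mu> x a = (INF \<alpha>. Q_MFG_policy h \<mu> \<alpha> x a)"

end

text \<open>
  For the time step \<open>h\<close>, \<open>\<mu>\<close> is a limiting law of the policy \<open>\<alpha>\<close> if it is the limit of the laws
  of the chain that starts from \<open>\<nu>\<close> and whose transition probabilities are evaluated at \<open>\<mu>\<close>
  itself. On a finite state space, convergence of laws is convergence of the point masses.
\<close>

definition limiting_law ::
  "(real \<Rightarrow> 'x \<Rightarrow> 'a \<Rightarrow> 'x pmf \<Rightarrow> 'x pmf) \<Rightarrow> 'x pmf \<Rightarrow> real \<Rightarrow> ('x \<Rightarrow> 'a) \<Rightarrow> 'x pmf \<Rightarrow> bool" where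
  "limiting_law p \<nu> h \<alpha> \<mu> \<longleftrightarrow>
     (\<forall>s. (\<lambda>k. measure (chain p h \<mu> (\<lambda>_. \<alpha>) \<nu>) {\<omega>. \<omega> k = s}) \<longlonglongrightarrow> pmf \<mu> s)"

text \<open>
  Below, \<open>m h \<alpha>\<close> is the limiting law of the policy \<open>\<alpha>\<close>, which depends on the time step \<open>h\<close>
  through the transition probabilities.
\<close>

context
  fixes \<gamma> :: real
    and f :: "'x \<Rightarrow> 'a \<Rightarrow> 'x pmf \<Rightarrow> real"
    and p :: "real \<Rightarrow> 'x \<Rightarrow> 'a \<Rightarrow> 'x pmf \<Rightarrow> 'x pmf"
    and m :: "real \<Rightarrow> ('x \<Rightarrow> 'a) \<Rightarrow> 'x pmf"
begin

definition V_MFC_policy :: "real \<Rightarrow> ('x \<Rightarrow> 'a) \<Rightarrow> 'x \<Rightarrow> real" where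
  "V_MFC_policy h \<alpha> x =
     (\<integral>\<omega>. h * (\<Sum>k. exp (- real k * \<gamma> * h) * f (\<omega> k) (\<alpha> (\<omega> k)) (m h \<alpha>))
        \<partial>chain p h (m h \<alpha>) (\<lambda>_. \<alpha>) (return_pmf x))"

text \<open>The sum over \<open>k \<ge> 1\<close> is indexed by \<open>Suc k\<close>; the modified policy is \<open>\<alpha>(x := a)\<close>.\<close>

definition Q_MFC_policy :: "real \<Rightarrow> ('x \<Rightarrow> 'a) \<Rightarrow> 'x \<Rightarrow> 'a \<Rightarrow> real" where
  "Q_MFC_policy h \<alpha> x a =
     h * f x a (m h (\<alpha>(x := a))) +
     (\<integral>\<omega>. h * (\<Sum>k. exp (- real (Suc k) * \<gamma> * h) * f (\<omega> (Suc k)) (\<alpha> (\<omega> (Suc k))) (m h \<alpha>))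
        \<partial>chain p h (m h \<alpha>) (first_action a \<alpha>) (return_pmf x))"

definition V_MFC :: "real \<Rightarrow> 'x \<Rightarrow> real" where
  "V_MFC h x = (INF \<alpha>. V_MFC_policy h \<alpha> x)"

definition Q_MFC :: "real \<Rightarrow> 'x \<Rightarrow> 'a \<Rightarrow> real" where
  "Q_MFC h x a = (INF \<alpha>. Q_MFC_policy h \<alpha> x a)"

end

section \<open>The infinitesimal generator\<close>

text \<open>
  The generator is the limit of the following quotients as \<open>h\<close> tends to \<open>0\<close> from the right. For the
  mean field control problem the limit has to be uniform in the measure argument: the quotient is
  evaluated at \<open>m h \<alpha>\<close>, which moves with \<open>h\<close>, and a limit for each fixed measure gives no bound
  along \<open>m h \<alpha>\<close>, even if the generator is bounded.
\<close>

definition difference_quotient ::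
  "(real \<Rightarrow> 'x \<Rightarrow> 'a \<Rightarrow> 'x pmf \<Rightarrow> 'x pmf) \<Rightarrow> real \<Rightarrow> 'x \<Rightarrow> 'x \<Rightarrow> 'a \<Rightarrow> 'x pmf \<Rightarrow> real" where
  "difference_quotient p h x' x a \<mu> = (pmf (p h x a \<mu>) x' - pmf (return_pmf x) x') / h"

end

theory Submission
  imports Defs
begin

text \<open>
  Fix a policy and a measure argument. Conditioning on the first step, the value function and
  the Q-function satisfy
  \<open>V x = h f x (\<alpha> x) + exp (- \<gamma> h) E[V Y]\<close> and \<open>Q x a = h f x a + exp (- \<gamma> h) E[V Y']\<close>, where
  \<open>Y\<close> and \<open>Y'\<close> are distributed according to the one-step transitions from \<open>x\<close> under the actions
  \<open>\<alpha> x\<close> and \<open>a\<close>. If \<open>\<bar>f\<bar>\<close> is at most \<open>M\<close>, the running costs contribute at most \<open>2 M h\<close> to \<open>Q - V\<close>.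
  The geometric series gives \<open>\<bar>V\<bar> \<le> h M / (1 - exp (- \<gamma> h)) = O(1)\<close>, so the terms at the next
  state contribute at most \<open>O(1)\<close> times the distance of the two transition laws, and this
  distance is \<open>O(h)\<close> because both laws differ from the point mass at \<open>x\<close> by \<open>h\<close> times a bounded
  difference quotient. The constant does not depend on the policy, so the bound passes to the
  infima over policies.

  The mean field control functions of a policy \<open>\<alpha>\<close> are the mean field game functions at the
  measure \<open>m h \<alpha>\<close>, up to a change of the measure in the running cost at time \<open>0\<close>, which costs
  another \<open>2 M h\<close>. As \<open>m h \<alpha>\<close> moves with \<open>h\<close>, the difference quotients must be bounded uniformly
  in the measure; this is what uniform convergence to the bounded generator provides.

  The first-step equations rest on the lemmas \<open>measure_path_cylinder_coordinate\<close> and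
  \<open>discounted_cost_first_step\<close>, the estimate for one policy is \<open>Q_MFG_policy_minus_V_MFG_policy\<close>.
\<close>

section \<open>Marginal laws of the chain\<close>

text \<open>
  The law after \<open>k\<close> steps from a given state. The recursion splits off the first step rather than
  the last one, as the first-step analysis of the expected cost does.
\<close>

primrec law_after :: "(nat \<Rightarrow> 'x \<Rightarrow> 'x pmf) \<Rightarrow> nat \<Rightarrow> 'x \<Rightarrow> 'x pmf" where
  "law_after K 0 x = return_pmf x"
| "law_after K (Suc k) x = bind_pmf (K 0 x) (law_after (\<lambda>n. K (Suc n)) k)"

lemma measurable_coordinate_path_measure [measurable]:
  "(\<lambda>\<omega>. \<omega> k) \<in> path_measure \<nu> K \<rightarrow>\<^sub>M count_space UNIV"
proof -
  have "(\<lambda>\<omega>. \<omega> k) \<in> PiM UNIV (\<lambda>_. count_space UNIV) \<rightarrow>\<^sub>M count_space UNIV"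
    by (rule measurable_component_singleton) simp
  then show ?thesis
    by (simp add: measurable_cong_sets[OF sets_path_measure refl])
qed

lemma space_path_measure [simp]: "space (path_measure \<nu> K) = UNIV"
  using sets_eq_imp_space_eq[OF sets_path_measure[of \<nu> K]] by (simp add: space_PiM)

lemma sets_path_measure_Collect_coordinates:
  "{\<omega>. (\<forall>i\<le>n. \<omega> i = s i) \<and> \<omega> k = y} \<in> sets (path_measure \<nu> K)"
proof -
  have "{\<omega>\<in>space (path_measure \<nu> K). (\<forall>i\<le>n. \<omega> i = s i) \<and> \<omega> k = y} \<in> sets (path_measure \<nu> K)"
    by measurable
  then show ?thesis
    by simp
qed

text \<open>
  The Markov property for cylinder events. Keeping the whole initial segment in the event makes
  the induction on \<open>k\<close> work: summing over the state at time \<open>Suc n\<close> lengthens the segment by one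
  and shortens the gap by one.
\<close>

lemma measure_path_cylinder_coordinate:
  fixes K :: "nat \<Rightarrow> 'x::finite \<Rightarrow> 'x pmf"
  shows "measure (path_measure \<nu> K) {\<omega>. (\<forall>i\<le>n. \<omega> i = s i) \<and> \<omega> (n + k) = y} =
    measure (path_measure \<nu> K) {\<omega>. \<forall>i\<le>n. \<omega> i = s i} * pmf (law_after (\<lambda>j. K (n + j)) k (s n)) y"
proof (induction k arbitrary: n s)
  case 0
  have "{\<omega>. (\<forall>i\<le>n. \<omega> i = s i) \<and> \<omega> (n + 0) = y} = (if y = s n then {\<omega>. \<forall>i\<le>n. \<omega> i = s i} else {})"
    by auto
  then show ?case
    by simp
next
  case (Suc k)
  interpret prob_space "path_measure \<nu> K"
    by (rule prob_space_path_measure)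
  let ?s = "\<lambda>z. s(Suc n := z)"
  let ?E = "\<lambda>z. {\<omega>. (\<forall>i\<le>Suc n. \<omega> i = ?s z i) \<and> \<omega> (Suc n + k) = y}"
  have extend: "(\<forall>i\<le>Suc n. \<omega> i = ?s z i) \<longleftrightarrow> (\<forall>i\<le>n. \<omega> i = s i) \<and> \<omega> (Suc n) = z" for \<omega> z
    by (auto simp: le_Suc_eq)
  have "{\<omega>. (\<forall>i\<le>n. \<omega> i = s i) \<and> \<omega> (n + Suc k) = y} = (\<Union>z. ?E z)"
    unfolding extend by auto
  also have "prob \<dots> = (\<Sum>z\<in>UNIV. prob (?E z))"
  proof (rule finite_measure_finite_Union)
    show "range ?E \<subseteq> events"
      by (intro image_subsetI sets_path_measure_Collect_coordinates)
    show "disjoint_family ?E"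
      unfolding extend by (auto simp: disjoint_family_on_def)
  qed simp
  also have "\<dots> = (\<Sum>z\<in>UNIV. prob {\<omega>. \<forall>i\<le>n. \<omega> i = s i} * pmf (K n (s n)) z *
      pmf (law_after (\<lambda>j. K (Suc n + j)) k z) y)"
  proof (rule sum.cong)
    fix z
    have "(\<Prod>i<n. pmf (K i (?s z i)) (?s z (Suc i))) = (\<Prod>i<n. pmf (K i (s i)) (s (Suc i)))"
      by (rule prod.cong) auto
    then have "prob {\<omega>. \<forall>i\<le>Suc n. \<omega> i = ?s z i} = prob {\<omega>. \<forall>i\<le>n. \<omega> i = s i} * pmf (K n (s n)) z"
      unfolding measure_path_cylinder by simp
    then show "prob (?E z) = prob {\<omega>. \<forall>i\<le>n. \<omega> i = s i} * pmf (K n (s n)) z *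
        pmf (law_after (\<lambda>j. K (Suc n + j)) k z) y"
      unfolding Suc.IH by simp
  qed simp
  also have "\<dots> = prob {\<omega>. \<forall>i\<le>n. \<omega> i = s i} * pmf (law_after (\<lambda>j. K (n + j)) (Suc k) (s n)) y"
    by (simp add: pmf_bind integral_measure_pmf[where A=UNIV] sum_distrib_left mult.assoc)
  finally show ?case .
qed

lemma distr_path_measure_return_pmf:
  fixes K :: "nat \<Rightarrow> 'x::finite \<Rightarrow> 'x pmf"
  shows "distr (path_measure (return_pmf x) K) (count_space UNIV) (\<lambda>\<omega>. \<omega> k) =
    measure_pmf (law_after K k x)"
proof (rule measure_eqI_countable[where A=UNIV])
  interpret prob_space "path_measure (return_pmf x) K"
    by (rule prob_space_path_measure)
  fix y
  let ?x = "\<lambda>_::nat. x"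
  have start: "prob {\<omega>. \<forall>i\<le>0. \<omega> i = ?x i} = 1"
    unfolding measure_path_cylinder by simp
  have [measurable]: "{\<omega>. \<omega> 0 = x} \<in> events" "{\<omega>. \<omega> k = y} \<in> events"
    using sets_path_measure_Collect_coordinates[of 0 ?x 0 x]
      measurable_sets[OF measurable_coordinate_path_measure, of "{y}" k "return_pmf x" K]
    by (simp_all add: vimage_def)
  have "prob {\<omega>. \<omega> k = y} = prob {\<omega>. (\<forall>i\<le>0. \<omega> i = ?x i) \<and> \<omega> (0 + k) = y}"
  proof (rule finite_measure_eq_AE)
    show "AE \<omega> in path_measure (return_pmf x) K.
        \<omega> \<in> {\<omega>. \<omega> k = y} \<longleftrightarrow> \<omega> \<in> {\<omega>. (\<forall>i\<le>0. \<omega> i = ?x i) \<and> \<omega> (0 + k) = y}"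
      using AE_prob_1[OF start] by eventually_elim auto
  qed (use sets_path_measure_Collect_coordinates[of 0 ?x "0 + k" y] in auto)
  also have "\<dots> = pmf (law_after K k x) y"
    unfolding measure_path_cylinder_coordinate start by simp
  finally show "emeasure (distr (path_measure (return_pmf x) K) (count_space UNIV) (\<lambda>\<omega>. \<omega> k)) {y} =
      emeasure (measure_pmf (law_after K k x)) {y}"
    by (subst emeasure_distr)
      (auto simp: vimage_def emeasure_eq_measure emeasure_pmf_single)
qed (auto simp: emeasure_distr prob_space.emeasure_space_1[OF prob_space_path_measure, simplified])

section \<open>First-step analysis of discounted costs\<close>

definition discounted_cost ::
  "real \<Rightarrow> (nat \<Rightarrow> 'x \<Rightarrow> real) \<Rightarrow> (nat \<Rightarrow> 'x \<Rightarrow> 'x pmf) \<Rightarrow> 'x \<Rightarrow> real" where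
  "discounted_cost r c K x = (\<integral>\<omega>. (\<Sum>k. r ^ k * c k (\<omega> k)) \<partial>path_measure (return_pmf x) K)"

lemma abs_expectation_pmf_le:
  fixes q :: "'x::finite pmf" and \<phi> :: "'x \<Rightarrow> real"
  assumes "\<And>y. \<bar>\<phi> y\<bar> \<le> M"
  shows "\<bar>measure_pmf.expectation q \<phi>\<bar> \<le> M"
proof -
  have "\<bar>measure_pmf.expectation q \<phi>\<bar> \<le> measure_pmf.expectation q (\<lambda>y. \<bar>\<phi> y\<bar>)"
    by (rule integral_abs_bound)
  also have "\<dots> \<le> M"
    using assms by (intro measure_pmf.integral_le_const integrable_measure_pmf_finite) auto
  finally show ?thesis .
qed

lemma summable_discounted:
  fixes a :: "nat \<Rightarrow> real"
  assumes "0 \<le> r" "r < 1" "\<And>k. \<bar>a k\<bar> \<le> M"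
  shows "summable (\<lambda>k. \<bar>r ^ k * a k\<bar>)"
proof (rule summable_comparison_test'[where N=0])
  show "summable (\<lambda>k. r ^ k * M)"
    using assms by (intro summable_mult2 summable_geometric) simp
  show "norm \<bar>r ^ k * a k\<bar> \<le> r ^ k * M" for k
    using assms by (simp add: abs_mult mult_left_mono)
qed

lemma discounted_cost_eq_suminf:
  fixes c :: "nat \<Rightarrow> 'x::finite \<Rightarrow> real"
  assumes r: "0 \<le> r" "r < 1" and c: "\<And>k x. \<bar>c k x\<bar> \<le> M"
  shows "discounted_cost r c K x = (\<Sum>k. r ^ k * measure_pmf.expectation (law_after K k x) (c k))"
proof -
  let ?P = "path_measure (return_pmf x) K"
  interpret prob_space ?P
    by (rule prob_space_path_measure)
  have [measurable]: "(\<lambda>\<omega>. c k (\<omega> k)) \<in> borel_measurable ?P" for k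
    by (rule measurable_compose[OF measurable_coordinate_path_measure]) simp
  have integrable: "integrable ?P (\<lambda>\<omega>. c k (\<omega> k))" for k
    using c by (intro integrable_const_bound[where B=M]) auto
  have coordinate: "(\<integral>\<omega>. \<phi> (\<omega> k) \<partial>?P) = measure_pmf.expectation (law_after K k x) \<phi>"
    for \<phi> :: "'x \<Rightarrow> real" and k
    unfolding distr_path_measure_return_pmf[symmetric] by (rule integral_distr[symmetric]) auto
  have "(\<integral>\<omega>. norm (r ^ k * c k (\<omega> k)) \<partial>?P) =
      \<bar>r ^ k * measure_pmf.expectation (law_after K k x) (\<lambda>y. \<bar>c k y\<bar>)\<bar>" for k
    using r coordinate[of "\<lambda>y. \<bar>c k y\<bar>" k] by (simp add: abs_mult)
  then have "summable (\<lambda>k. \<integral>\<omega>. norm (r ^ k * c k (\<omega> k)) \<partial>?P)"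
    using c by (simp only:) (intro summable_discounted r abs_expectation_pmf_le; simp)
  then show ?thesis
    unfolding discounted_cost_def
    using summable_discounted[OF r c] integrable coordinate
    by (subst integral_suminf) auto
qed

lemma abs_discounted_cost_le:
  fixes c :: "nat \<Rightarrow> 'x::finite \<Rightarrow> real"
  assumes r: "0 \<le> r" "r < 1" and c: "\<And>k x. \<bar>c k x\<bar> \<le> M"
  shows "\<bar>discounted_cost r c K x\<bar> \<le> M / (1 - r)"
proof -
  let ?e = "\<lambda>k. measure_pmf.expectation (law_after K k x) (c k)"
  have e: "\<bar>?e k\<bar> \<le> M" for k
    by (rule abs_expectation_pmf_le) (rule c)
  have "\<bar>\<Sum>k. r ^ k * ?e k\<bar> \<le> (\<Sum>k. \<bar>r ^ k * ?e k\<bar>)"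
    by (rule summable_rabs) (rule summable_discounted[OF r e])
  also have "\<dots> \<le> (\<Sum>k. r ^ k * M)"
    using r e by (intro suminf_le summable_discounted summable_mult2 summable_geometric)
      (auto simp: abs_mult mult_left_mono)
  also have "\<dots> = M / (1 - r)"
    using r by (simp add: suminf_mult2[symmetric] suminf_geometric summable_geometric)
  finally show ?thesis
    unfolding discounted_cost_eq_suminf[OF r c] .
qed

text \<open>
  Cost and kernel may depend on time, so that a chain with a prescribed first action is covered:
  after the shift by one step, only the stationary policy remains. The same freedom allows the
  cost at time \<open>0\<close> to be switched off.
\<close>

lemma discounted_cost_first_step:
  fixes c :: "nat \<Rightarrow> 'x::finite \<Rightarrow> real"
  assumes r: "0 \<le> r" "r < 1" and c: "\<And>k x. \<bar>c k x\<bar> \<le> M"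
  shows "discounted_cost r c K x = c 0 x +
    r * (\<Sum>y\<in>UNIV. pmf (K 0 x) y * discounted_cost r (\<lambda>k. c (Suc k)) (\<lambda>k. K (Suc k)) y)"
proof -
  let ?e = "\<lambda>k y. measure_pmf.expectation (law_after (\<lambda>k. K (Suc k)) k y) (c (Suc k))"
  have e: "\<bar>?e k y\<bar> \<le> M" for k y
    by (rule abs_expectation_pmf_le) (rule c)
  have summable: "summable (\<lambda>k. r ^ k * ?e k y)" for y
    by (rule summable_rabs_cancel) (rule summable_discounted[OF r e])
  have "summable (\<lambda>k. \<bar>r ^ k * measure_pmf.expectation (law_after K k x) (c k)\<bar>)"
    by (rule summable_discounted[OF r abs_expectation_pmf_le[OF c]])
  then have summable_cost: "summable (\<lambda>k. r ^ k * measure_pmf.expectation (law_after K k x) (c k))"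
    by (rule summable_rabs_cancel)
  have first_step: "measure_pmf.expectation (law_after K (Suc k) x) (c (Suc k)) =
      (\<Sum>y\<in>UNIV. pmf (K 0 x) y * ?e k y)" for k
    by (simp add: pmf_expectation_bind[where A=UNIV])
  have "discounted_cost r c K x = c 0 x +
      (\<Sum>k. r ^ Suc k * measure_pmf.expectation (law_after K (Suc k) x) (c (Suc k)))"
    unfolding discounted_cost_eq_suminf[OF r c]
    using suminf_split_head[OF summable_cost] by simp
  also have "(\<Sum>k. r ^ Suc k * measure_pmf.expectation (law_after K (Suc k) x) (c (Suc k))) =
      (\<Sum>k. \<Sum>y\<in>UNIV. r * (pmf (K 0 x) y * (r ^ k * ?e k y)))"
    unfolding first_step by (simp add: sum_distrib_left mult_ac)
  also have "\<dots> = (\<Sum>y\<in>UNIV. \<Sum>k. r * (pmf (K 0 x) y * (r ^ k * ?e k y)))"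
    by (rule suminf_sum) (intro summable_mult summable)
  also have "\<dots> = r * (\<Sum>y\<in>UNIV. pmf (K 0 x) y * (\<Sum>k. r ^ k * ?e k y))"
    using summable by (simp add: suminf_mult summable_mult sum_distrib_left)
  finally show ?thesis
    unfolding discounted_cost_eq_suminf[OF r c] .
qed

section \<open>One policy\<close>

lemma exp_discount_power: "exp (- real k * \<gamma> * h) = exp (- \<gamma> * h) ^ k"
  by (simp add: exp_of_nat_mult[symmetric] mult.assoc)

lemma V_MFG_policy_eq_discounted_cost:
  "V_MFG_policy \<gamma> f p h \<mu> \<alpha> x =
    h * discounted_cost (exp (- \<gamma> * h)) (\<lambda>_ y. f y (\<alpha> y) \<mu>) (\<lambda>_ y. p h y (\<alpha> y) \<mu>) x"
  unfolding V_MFG_policy_def discounted_cost_def chain_def exp_discount_power by simp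

lemma Q_MFG_policy_eq_discounted_cost:
  "Q_MFG_policy \<gamma> f p h \<mu> \<alpha> x a =
    h * discounted_cost (exp (- \<gamma> * h)) (\<lambda>k y. f y (first_action a \<alpha> k y) \<mu>)
      (\<lambda>k y. p h y (first_action a \<alpha> k y) \<mu>) x"
  unfolding Q_MFG_policy_def discounted_cost_def chain_def exp_discount_power by simp

context
  fixes \<gamma> h :: real and f :: "'x::finite \<Rightarrow> 'a \<Rightarrow> 'x pmf \<Rightarrow> real" and \<mu> :: "'x pmf" and M :: real
  assumes gamma: "\<gamma> > 0" and h: "h > 0" and f: "\<And>x a. \<bar>f x a \<mu>\<bar> \<le> M"
begin

lemma V_MFG_policy_first_step:
  "V_MFG_policy \<gamma> f p h \<mu> \<alpha> x = h * f x (\<alpha> x) \<mu> +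
    exp (- \<gamma> * h) * (\<Sum>y\<in>UNIV. pmf (p h x (\<alpha> x) \<mu>) y * V_MFG_policy \<gamma> f p h \<mu> \<alpha> y)"
  unfolding V_MFG_policy_eq_discounted_cost
  using gamma h f
  by (subst discounted_cost_first_step[where M=M]) (auto simp: algebra_simps sum_distrib_left)

lemma Q_MFG_policy_first_step:
  "Q_MFG_policy \<gamma> f p h \<mu> \<alpha> x a = h * f x a \<mu> +
    exp (- \<gamma> * h) * (\<Sum>y\<in>UNIV. pmf (p h x a \<mu>) y * V_MFG_policy \<gamma> f p h \<mu> \<alpha> y)"
  unfolding V_MFG_policy_eq_discounted_cost Q_MFG_policy_eq_discounted_cost
  using gamma h f
  by (subst discounted_cost_first_step[where M=M])
    (auto simp: algebra_simps sum_distrib_left first_action_def)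

text \<open>
  In the mean field control Q-function the cost at time \<open>0\<close> is charged separately, so the
  expectation in it is the discounted cost of the chain with no cost at time \<open>0\<close>.
\<close>

lemma Q_MFC_policy_eq_Q_MFG_policy:
  assumes \<mu>: "m h \<alpha> = \<mu>"
  shows "Q_MFC_policy \<gamma> f p m h \<alpha> x a =
    Q_MFG_policy \<gamma> f p h \<mu> \<alpha> x a + h * (f x a (m h (\<alpha>(x := a))) - f x a \<mu>)"
proof -
  let ?r = "exp (- \<gamma> * h)"
  let ?c = "\<lambda>k y. if k = 0 then 0 else f y (\<alpha> y) \<mu>"
  let ?K = "\<lambda>k y. p h y (first_action a \<alpha> k y) \<mu>"
  have r: "0 \<le> ?r" "?r < 1"
    using gamma h by auto
  have "0 \<le> M"
    using abs_ge_zero[of "f x a \<mu>"] f[of x a] by linarith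
  then have c: "\<bar>?c k y\<bar> \<le> M" for k :: nat and y
    using f by simp
  have "(\<Sum>k. ?r ^ Suc k * f (\<omega> (Suc k)) (\<alpha> (\<omega> (Suc k))) \<mu>) = (\<Sum>k. ?r ^ k * ?c k (\<omega> k))" for \<omega>
    using suminf_split_head[OF summable_rabs_cancel[OF summable_discounted[OF r c]], of "\<lambda>k. k" \<omega>]
    by simp
  then have "Q_MFC_policy \<gamma> f p m h \<alpha> x a =
      h * f x a (m h (\<alpha>(x := a))) + h * discounted_cost ?r ?c ?K x"
    unfolding Q_MFC_policy_def \<mu> discounted_cost_def chain_def exp_discount_power by simp
  also have "h * discounted_cost ?r ?c ?K x = Q_MFG_policy \<gamma> f p h \<mu> \<alpha> x a - h * f x a \<mu>"
    unfolding Q_MFG_policy_first_step V_MFG_policy_eq_discounted_cost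
    by (subst discounted_cost_first_step[OF r c])
      (simp add: first_action_def sum_distrib_left mult_ac)
  finally show ?thesis
    unfolding right_diff_distrib by linarith
qed

lemma abs_V_MFG_policy_le:
  "\<bar>V_MFG_policy \<gamma> f p h \<mu> \<alpha> x\<bar> \<le> M * (1 / \<gamma> + h)"
proof -
  let ?r = "exp (- \<gamma> * h)"
  have r: "0 \<le> ?r" "?r < 1"
    using gamma h by auto
  have "0 \<le> M"
    using abs_ge_zero[of "f x (\<alpha> x) \<mu>"] f[of x "\<alpha> x"] by linarith
  \<comment> \<open>This is \<open>1 + t \<le> exp t\<close> at \<open>t = \<gamma> h\<close>, rearranged.\<close>
  have "h / (1 - ?r) \<le> 1 / \<gamma> + h"
  proof -
    have pos: "0 < 1 + \<gamma> * h"
      using gamma h by (simp add: add_pos_pos)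
    have "?r = 1 / exp (\<gamma> * h)"
      by (simp add: exp_minus field_simps)
    also have "\<dots> \<le> 1 / (1 + \<gamma> * h)"
      using pos exp_ge_add_one_self[of "\<gamma> * h"] by (intro divide_left_mono) auto
    finally have "?r * (1 + \<gamma> * h) \<le> 1"
      using pos by (simp add: field_simps)
    then have "\<gamma> * h \<le> (1 + \<gamma> * h) * (1 - ?r)"
      by (simp add: algebra_simps)
    then show ?thesis
      using r gamma by (simp add: field_simps)
  qed
  then have "M * (h / (1 - ?r)) \<le> M * (1 / \<gamma> + h)"
    using \<open>0 \<le> M\<close> by (rule mult_left_mono)
  moreover have "\<bar>V_MFG_policy \<gamma> f p h \<mu> \<alpha> x\<bar> \<le> h * (M / (1 - ?r))"
    unfolding V_MFG_policy_eq_discounted_cost abs_mult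
    using h f r by (intro mult_mono abs_discounted_cost_le) auto
  ultimately show ?thesis
    by (simp add: mult.commute)
qed

text \<open>
  Subtracting the two first-step equations leaves the difference of two running costs and the
  integral of the value function against the difference of two transition laws. In that
  difference the point mass at \<open>x\<close> cancels, so each of its weights is at most \<open>2 D h\<close>.
\<close>

lemma Q_MFG_policy_minus_V_MFG_policy:
  assumes D: "\<And>x' x a. \<bar>difference_quotient p h x' x a \<mu>\<bar> \<le> D"
  shows "\<bar>Q_MFG_policy \<gamma> f p h \<mu> \<alpha> x a - V_MFG_policy \<gamma> f p h \<mu> \<alpha> x\<bar> \<le>
    (2 * M + real CARD('x) * (2 * D) * (M * (1 / \<gamma> + h))) * h"
proof -
  let ?r = "exp (- \<gamma> * h)"
  let ?V = "V_MFG_policy \<gamma> f p h \<mu> \<alpha>"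
  let ?d = "\<lambda>y. pmf (p h x a \<mu>) y - pmf (p h x (\<alpha> x) \<mu>) y"
  have r: "0 \<le> ?r" "?r \<le> 1"
    using gamma h by auto
  have "\<bar>?d y\<bar> \<le> 2 * D * h" for y
  proof -
    have "?d y = (difference_quotient p h y x a \<mu> - difference_quotient p h y x (\<alpha> x) \<mu>) * h"
      using h by (simp add: difference_quotient_def field_simps)
    moreover have "\<bar>difference_quotient p h y x a \<mu> - difference_quotient p h y x (\<alpha> x) \<mu>\<bar> \<le> 2 * D"
      using D[of y x a] D[of y x "\<alpha> x"] by linarith
    ultimately show ?thesis
      using h by (simp add: abs_mult mult_right_mono)
  qed
  then have "\<bar>?d y * ?V y\<bar> \<le> 2 * D * h * (M * (1 / \<gamma> + h))" for y
    unfolding abs_mult using abs_V_MFG_policy_le by (intro mult_mono') auto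
  then have "\<bar>\<Sum>y\<in>UNIV. ?d y * ?V y\<bar> \<le> (\<Sum>y\<in>(UNIV::'x set). 2 * D * h * (M * (1 / \<gamma> + h)))"
    by (intro order_trans[OF sum_abs] sum_mono)
  then have next_state: "\<bar>?r * (\<Sum>y\<in>UNIV. ?d y * ?V y)\<bar> \<le>
      real CARD('x) * (2 * D) * (M * (1 / \<gamma> + h)) * h"
    using mult_mono[OF r(2), of "\<bar>\<Sum>y\<in>UNIV. ?d y * ?V y\<bar>"] r by (simp add: abs_mult mult_ac)
  have "\<bar>f x a \<mu> - f x (\<alpha> x) \<mu>\<bar> \<le> 2 * M"
    using f[of x a] f[of x "\<alpha> x"] by linarith
  then have running: "\<bar>h * (f x a \<mu> - f x (\<alpha> x) \<mu>)\<bar> \<le> 2 * M * h"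
    using h by (simp add: abs_mult)
  have "Q_MFG_policy \<gamma> f p h \<mu> \<alpha> x a - ?V x =
      h * (f x a \<mu> - f x (\<alpha> x) \<mu>) + ?r * (\<Sum>y\<in>UNIV. ?d y * ?V y)"
    unfolding Q_MFG_policy_first_step V_MFG_policy_first_step[of p \<alpha> x]
    by (simp add: algebra_simps sum_subtractf)
  then show ?thesis
    using running next_state by (simp add: algebra_simps)
qed

end

section \<open>Infima over policies\<close>

lemma abs_INF_diff_le:
  fixes F H :: "'b::finite \<Rightarrow> real"
  assumes "\<And>i. \<bar>F i - H i\<bar> \<le> C"
  shows "\<bar>(INF i. F i) - (INF i. H i)\<bar> \<le> C"
proof -
  have "(INF i. F i) - C \<le> (INF i. H i)" if "\<And>i. \<bar>F i - H i\<bar> \<le> C" for F H :: "'b \<Rightarrow> real"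
  proof (rule cINF_greatest)
    fix i
    have "(INF i. F i) \<le> F i"
      by (rule cINF_lower) auto
    then show "(INF i. F i) - C \<le> H i"
      using that[of i] by linarith
  qed simp
  from this[of F H] this[of H F] show ?thesis
    using assms by (auto simp: abs_minus_commute abs_le_iff algebra_simps)
qed

theorem corollary5:
  fixes \<gamma> :: real
    and f :: "'x::finite \<Rightarrow> 'a::finite \<Rightarrow> 'x pmf \<Rightarrow> real"
    and p :: "real \<Rightarrow> 'x \<Rightarrow> 'a \<Rightarrow> 'x pmf \<Rightarrow> 'x pmf"
    and G :: "'x \<Rightarrow> 'x \<Rightarrow> 'a \<Rightarrow> 'x pmf \<Rightarrow> real"
    and \<nu> :: "'x pmf"
    and m :: "real \<Rightarrow> ('x \<Rightarrow> 'a) \<Rightarrow> 'x pmf"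
  assumes gamma_pos: "\<gamma> > 0"
    and f_nonneg: "\<And>x a \<mu>. f x a \<mu> \<ge> 0"
    and f_bounded: "bounded (range (\<lambda>(x, a, \<mu>). f x a \<mu>))"
    and limiting_laws: "\<And>h \<alpha>. h > 0 \<Longrightarrow> limiting_law p \<nu> h \<alpha> (m h \<alpha>)"
    and generator: "\<And>x' x a \<mu>.
      ((\<lambda>h. difference_quotient p h x' x a \<mu>) \<longlongrightarrow> G x' x a \<mu>) (at_right 0)"
    and generator_bounded: "bounded (range (\<lambda>(x', x, a, \<mu>). G x' x a \<mu>))"
  shows "(\<forall>\<mu> x a. (\<lambda>h. Q_MFG \<gamma> f p h \<mu> x a - V_MFG \<gamma> f p h \<mu> x) \<in> O[at_right 0](\<lambda>h. h)) \<and>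
    (uniform_limit UNIV (\<lambda>h (x', x, a, \<mu>). difference_quotient p h x' x a \<mu>)
        (\<lambda>(x', x, a, \<mu>). G x' x a \<mu>) (at_right 0) \<longrightarrow>
      (\<forall>x a. (\<lambda>h. Q_MFC \<gamma> f p m h x a - V_MFC \<gamma> f p m h x) \<in> O[at_right 0](\<lambda>h. h)))"
proof (intro conjI allI impI)
  obtain M where M: "\<And>x a \<mu>. \<bar>f x a \<mu>\<bar> \<le> M"
    using f_bounded by (fastforce simp: bounded_iff)
  obtain B where B: "\<And>x' x a \<mu>. \<bar>G x' x a \<mu>\<bar> \<le> B"
    using generator_bounded by (fastforce simp: bounded_iff)
  have "0 \<le> M"
    using abs_ge_zero[of "f undefined undefined undefined"] M[of undefined undefined undefined]
    by linarith
  \<comment> \<open>Close to the limit, the difference quotients exceed the bound of the generator by at most 1.\<close>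
  define D where "D = B + 1"
  have "0 \<le> D"
    using abs_ge_zero[of "G undefined undefined undefined undefined"]
      B[of undefined undefined undefined undefined]
    unfolding D_def by linarith
  \<comment> \<open>The bound for one policy at \<open>h = 1\<close> dominates it for smaller \<open>h\<close>; the additional \<open>2 M\<close> is
    for the change of the measure in the first running cost of the control problem.\<close>
  define C where "C = 4 * M + real CARD('x) * (2 * D) * (M * (1 / \<gamma> + 1))"
  have policy: "\<bar>Q_MFG_policy \<gamma> f p h \<mu> \<alpha> x a - V_MFG_policy \<gamma> f p h \<mu> \<alpha> x\<bar> \<le> (C - 2 * M) * h"
    if "0 < h" "h < 1" "\<And>x' x a. \<bar>difference_quotient p h x' x a \<mu>\<bar> \<le> D" for h \<mu> \<alpha> x a
  proof -
    have "\<bar>Q_MFG_policy \<gamma> f p h \<mu> \<alpha> x a - V_MFG_policy \<gamma> f p h \<mu> \<alpha> x\<bar> \<le>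
        (2 * M + real CARD('x) * (2 * D) * (M * (1 / \<gamma> + h))) * h"
      by (rule Q_MFG_policy_minus_V_MFG_policy[OF gamma_pos that(1) M that(3)])
    also have "\<dots> \<le> (2 * M + real CARD('x) * (2 * D) * (M * (1 / \<gamma> + 1))) * h"
      using that(1,2) \<open>0 \<le> M\<close> \<open>0 \<le> D\<close>
      by (intro mult_right_mono add_left_mono mult_left_mono) auto
    finally show ?thesis
      by (simp add: C_def)
  qed
  have small: "eventually (\<lambda>h::real. 0 < h \<and> h < 1) (at_right 0)"
    by (auto simp: eventually_at_right_field intro!: exI[of _ 1])

  show "(\<lambda>h. Q_MFG \<gamma> f p h \<mu> x a - V_MFG \<gamma> f p h \<mu> x) \<in> O[at_right 0](\<lambda>h. h)" for \<mu> x a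
  proof (rule bigoI)
    have "eventually (\<lambda>h. \<bar>difference_quotient p h x' x a \<mu>\<bar> \<le> D) (at_right 0)" for x' x a
      using tendstoD[OF generator zero_less_one, of x' x a \<mu>]
    proof eventually_elim
      case (elim h)
      then show ?case
        using B[of x' x a \<mu>] unfolding D_def dist_real_def by linarith
    qed
    then have "eventually (\<lambda>h. \<forall>x' x a. \<bar>difference_quotient p h x' x a \<mu>\<bar> \<le> D) (at_right 0)"
      by (intro eventually_all_finite)
    with small
    show "eventually (\<lambda>h. norm (Q_MFG \<gamma> f p h \<mu> x a - V_MFG \<gamma> f p h \<mu> x) \<le> (C - 2 * M) * norm h)
        (at_right 0)"
    proof eventually_elim
      case (elim h)
      have "\<bar>Q_MFG \<gamma> f p h \<mu> x a - V_MFG \<gamma> f p h \<mu> x\<bar> \<le> (C - 2 * M) * h"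
        unfolding Q_MFG_def V_MFG_def using elim by (intro abs_INF_diff_le policy) auto
      then show ?case
        using elim by simp
    qed
  qed

  assume uniform: "uniform_limit UNIV (\<lambda>h (x', x, a, \<mu>). difference_quotient p h x' x a \<mu>)
    (\<lambda>(x', x, a, \<mu>). G x' x a \<mu>) (at_right 0)"
  show "(\<lambda>h. Q_MFC \<gamma> f p m h x a - V_MFC \<gamma> f p m h x) \<in> O[at_right 0](\<lambda>h. h)" for x a
  proof (rule bigoI)
    have "eventually (\<lambda>h. \<forall>x' x a \<mu>. \<bar>difference_quotient p h x' x a \<mu>\<bar> \<le> D) (at_right 0)"
      using uniform_limitD[OF uniform zero_less_one]
    proof eventually_elim
      case (elim h)
      show ?case
      proof (intro allI)
        fix x' x a \<mu>
        have "dist (difference_quotient p h x' x a \<mu>) (G x' x a \<mu>) < 1"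
          using elim by auto
        then show "\<bar>difference_quotient p h x' x a \<mu>\<bar> \<le> D"
          using B[of x' x a \<mu>] unfolding D_def dist_real_def by linarith
      qed
    qed
    with small
    show "eventually (\<lambda>h. norm (Q_MFC \<gamma> f p m h x a - V_MFC \<gamma> f p m h x) \<le> C * norm h) (at_right 0)"
    proof eventually_elim
      case (elim h)
      have "\<bar>Q_MFC_policy \<gamma> f p m h \<alpha> x a - V_MFC_policy \<gamma> f p m h \<alpha> x\<bar> \<le> C * h" for \<alpha>
      proof -
        let ?\<mu> = "m h \<alpha>"
        have "\<bar>f x a (m h (\<alpha>(x := a))) - f x a ?\<mu>\<bar> \<le> 2 * M"
          using M[of x a "m h (\<alpha>(x := a))"] M[of x a ?\<mu>] by linarith
        then have "\<bar>h * (f x a (m h (\<alpha>(x := a))) - f x a ?\<mu>)\<bar> \<le> 2 * M * h"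
          using elim by (simp add: abs_mult)
        moreover have "\<bar>Q_MFG_policy \<gamma> f p h ?\<mu> \<alpha> x a - V_MFG_policy \<gamma> f p h ?\<mu> \<alpha> x\<bar> \<le>
            (C - 2 * M) * h"
          using elim by (intro policy) auto
        moreover have "Q_MFC_policy \<gamma> f p m h \<alpha> x a = Q_MFG_policy \<gamma> f p h ?\<mu> \<alpha> x a +
            h * (f x a (m h (\<alpha>(x := a))) - f x a ?\<mu>)"
          using elim M by (intro Q_MFC_policy_eq_Q_MFG_policy[where M=M] gamma_pos) auto
        moreover have "V_MFC_policy \<gamma> f p m h \<alpha> x = V_MFG_policy \<gamma> f p h ?\<mu> \<alpha> x"
          unfolding V_MFC_policy_def V_MFG_policy_def ..
        ultimately show ?thesis
          by (simp add: algebra_simps)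
      qed
      then have "\<bar>Q_MFC \<gamma> f p m h x a - V_MFC \<gamma> f p m h x\<bar> \<le> C * h"
        unfolding Q_MFC_def V_MFC_def by (rule abs_INF_diff_le)
      then show ?case
        using elim by simp
    qed
  qed
qed

end
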